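(* Let $G=(V,E)$ be a locally finite, connected graph satisfying $CDE'(n,K)$, with $n>0$ and $K\in\mathbb R$. Let $T>0$, let $\alpha:[0,T]\to(0,\infty)$ be a smooth positive function and let $\gamma:[0,T]\to\mathbb R$ be a smooth non-positive function. For a positive and bounded function $f:V\to\mathbb R$ put $\phi(t,x)=P_t\big(\Gamma(\sqrt{P_{T-t}f})\big)(x)$ for $0\le t<T$, $x\in V$. Then for every positive and bounded $f$, at every $x\in V$ and every $0\le t<T$, $$\partial_t(\alpha\phi)\ \ge\ \Big(\alpha'-\frac{4\alpha\gamma}{n}+2\alpha K\Big)\phi+\frac{2\alpha\gamma}{n}\,\Delta P_Tf-\frac{2\alpha\gamma^2}{n}\,P_Tf .$$
   Context: $G=(V,E)$ is a finite or infinite connected graph with symmetric edge weights $\omega:V\times V\to[0,\infty)$, $\omega_{xy}=\omega_{yx}$, where $x\sim y$ iff $\omega_{xy}>0$; loops are allowed. Standing assumptions: $\omega_{\min}=\inf\{\omega_{xy}:\omega_{xy}>0\}>0$; $m(x):=\sum_{y\sim x}\omega_{xy}<\infty$ for all $x$; $\mu:V\to(0,\infty)$ is a measure with $D_\mu:=\sup_{x}m(x)/\mu(x)<\infty$. The Laplacian is $\Delta f(x)=\frac1{\mu(x)}\sum_{y\sim x}\omega_{xy}(f(y)-f(x))$. $2\Gamma(f,g)=\Delta(fg)-f\Delta g-g\Delta f$, $\Gamma(f)=\Gamma(f,f)$; $2\Gamma_2(f,g)=\Delta\Gamma(f,g)-\Gamma(f,\Delta g)-\Gamma(\Delta f,g)$,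 $\Gamma_2(f)=\Gamma_2(f,f)$; for $f>0$, $\widetilde\Gamma_2(f)=\Gamma_2(f)-\Gamma\left(f,\frac{\Gamma(f)}f\right)$. $G$ satisfies $CDE'(n,K)$ if for every $f:V\to(0,\infty)$ and every $x\in V$, $\widetilde\Gamma_2(f)(x)\ge\frac1n f(x)^2(\Delta\log f)(x)^2+K\,\Gamma(f)(x)$. Heat semigroup: $p(t,x,y)$ is the heat kernel of $G$ (the limit of the Dirichlet heat kernels along an exhaustion of $V$ by finite sets), and for bounded $f$, $P_tf(x)=\sum_{y\in V}\mu(y)p(t,x,y)f(y)=e^{t\Delta}f(x)=\sum_{k\ge0}\frac{t^k\Delta^kf(x)}{k!}$ (the definitions coincide since $D_\mu<\infty$ makes $\Delta$ bounded). *)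

theory Defs
  imports "HOL-Analysis.Analysis"
begin

text \<open>
  The vertex set is the whole type \<open>'v\<close>; the graph is carried by the edge weights \<open>\<omega>\<close>,
  with \<open>x \<sim> y\<close> iff \<open>\<omega> x y > 0\<close>.
\<close>

definition nbrs :: "('v \<Rightarrow> 'v \<Rightarrow> real) \<Rightarrow> 'v \<Rightarrow> 'v set" where
  "nbrs \<omega> x = {y. \<omega> x y > 0}"

definition degree_weight :: "('v \<Rightarrow> 'v \<Rightarrow> real) \<Rightarrow> 'v \<Rightarrow> real" where
  "degree_weight \<omega> x = (\<Sum>y\<in>nbrs \<omega> x. \<omega> x y)"

text \<open>
  The infimum and the supremum are taken in the extended reals, so that the infimum of the
  empty set (a single vertex without loop) is \<open>\<infinity>\<close>.
\<close>

definition omega_min :: "('v \<Rightarrow> 'v \<Rightarrow> real) \<Rightarrow> ereal" where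
  "omega_min \<omega> = Inf {ereal (\<omega> x y) | x y. \<omega> x y > 0}"

definition D_mu :: "('v \<Rightarrow> 'v \<Rightarrow> real) \<Rightarrow> ('v \<Rightarrow> real) \<Rightarrow> ereal" where
  "D_mu \<omega> \<mu> = (SUP x. ereal (degree_weight \<omega> x / \<mu> x))"

text \<open>
  Local finiteness makes all sums over neighbours finite sums; in particular it contains the
  requirement \<open>m(x) < \<infinity>\<close>.
\<close>

locale weighted_graph =
  fixes \<omega> :: "'v \<Rightarrow> 'v \<Rightarrow> real" and \<mu> :: "'v \<Rightarrow> real"
  assumes weight_nonneg: "\<And>x y. \<omega> x y \<ge> 0"
    and weight_sym: "\<And>x y. \<omega> x y = \<omega> y x"
    and locally_finite: "\<And>x. finite (nbrs \<omega> x)"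
    and connected: "\<And>x y. (x, y) \<in> {(u, v). \<omega> u v > 0}\<^sup>*"
    and omega_min_pos: "omega_min \<omega> > 0"
    and measure_pos: "\<And>x. \<mu> x > 0"
    and D_mu_finite: "D_mu \<omega> \<mu> < \<infinity>"

definition laplacian ::
    "('v \<Rightarrow> 'v \<Rightarrow> real) \<Rightarrow> ('v \<Rightarrow> real) \<Rightarrow> ('v \<Rightarrow> real) \<Rightarrow> 'v \<Rightarrow> real" where
  "laplacian \<omega> \<mu> f x = (1 / \<mu> x) * (\<Sum>y\<in>nbrs \<omega> x. \<omega> x y * (f y - f x))"

definition Gamma_form ::
    "('v \<Rightarrow> 'v \<Rightarrow> real) \<Rightarrow> ('v \<Rightarrow> real) \<Rightarrow> ('v \<Rightarrow> real) \<Rightarrow> ('v \<Rightarrow> real) \<Rightarrow> 'v \<Rightarrow> real" where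
  "Gamma_form \<omega> \<mu> f g x =
     (laplacian \<omega> \<mu> (\<lambda>y. f y * g y) x - f x * laplacian \<omega> \<mu> g x - g x * laplacian \<omega> \<mu> f x) / 2"

definition Gamma2_form ::
    "('v \<Rightarrow> 'v \<Rightarrow> real) \<Rightarrow> ('v \<Rightarrow> real) \<Rightarrow> ('v \<Rightarrow> real) \<Rightarrow> ('v \<Rightarrow> real) \<Rightarrow> 'v \<Rightarrow> real" where
  "Gamma2_form \<omega> \<mu> f g x =
     (laplacian \<omega> \<mu> (Gamma_form \<omega> \<mu> f g) x
      - Gamma_form \<omega> \<mu> f (laplacian \<omega> \<mu> g) x
      - Gamma_form \<omega> \<mu> (laplacian \<omega> \<mu> f) g x) / 2"

definition Gamma2_tilde ::
    "('v \<Rightarrow> 'v \<Rightarrow> real) \<Rightarrow> ('v \<Rightarrow> real) \<Rightarrow> ('v \<Rightarrow> real) \<Rightarrow> 'v \<Rightarrow> real" where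
  "Gamma2_tilde \<omega> \<mu> f x =
     Gamma2_form \<omega> \<mu> f f x - Gamma_form \<omega> \<mu> f (\<lambda>y. Gamma_form \<omega> \<mu> f f y / f y) x"

definition CDE' ::
    "('v \<Rightarrow> 'v \<Rightarrow> real) \<Rightarrow> ('v \<Rightarrow> real) \<Rightarrow> real \<Rightarrow> real \<Rightarrow> bool" where
  "CDE' \<omega> \<mu> n K \<longleftrightarrow>
     (\<forall>f. (\<forall>x. f x > 0) \<longrightarrow>
       (\<forall>x. Gamma2_tilde \<omega> \<mu> f x \<ge>
          (1 / n) * (f x)\<^sup>2 * (laplacian \<omega> \<mu> (\<lambda>y. ln (f y)) x)\<^sup>2 + K * Gamma_form \<omega> \<mu> f f x))"

text \<open>
  Dirichlet Laplacian of a finite set \<open>U\<close>: functions on \<open>U\<close> are extended by \<open>0\<close>, and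
  \<open>\<Delta>f\<close> is restricted to \<open>U\<close>.
\<close>

definition dirichlet_laplacian ::
    "('v \<Rightarrow> 'v \<Rightarrow> real) \<Rightarrow> ('v \<Rightarrow> real) \<Rightarrow> 'v set \<Rightarrow> ('v \<Rightarrow> real) \<Rightarrow> 'v \<Rightarrow> real" where
  "dirichlet_laplacian \<omega> \<mu> U f x =
     (if x \<in> U then laplacian \<omega> \<mu> (\<lambda>y. if y \<in> U then f y else 0) x else 0)"

text \<open>
  The kernel, with respect to \<open>\<mu>\<close>, of the semigroup generated by the Dirichlet Laplacian
  \<open>\<Delta>\<^sub>U\<close>: the entry \<open>(x, y)\<close> of the matrix exponential of \<open>t \<Delta>\<^sub>U\<close>, divided by \<open>\<mu> y\<close>.
\<close>

definition dirichlet_heat_kernel ::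
    "('v \<Rightarrow> 'v \<Rightarrow> real) \<Rightarrow> ('v \<Rightarrow> real) \<Rightarrow> 'v set \<Rightarrow> real \<Rightarrow> 'v \<Rightarrow> 'v \<Rightarrow> real" where
  "dirichlet_heat_kernel \<omega> \<mu> U t x y =
     (if x \<in> U \<and> y \<in> U
      then (\<Sum>k. t ^ k / fact k * (dirichlet_laplacian \<omega> \<mu> U ^^ k) (indicator {y}) x) / \<mu> y
      else 0)"

text \<open>
  The limit over the directed set of all finite vertex sets. It exists, since the Dirichlet
  kernels are nondecreasing in \<open>U\<close> and bounded by \<open>1 / \<mu> y\<close>, and it is also the limit along every
  exhaustion, since every finite set is eventually contained in the members of an exhaustion.
\<close>

definition heat_kernel ::
    "('v \<Rightarrow> 'v \<Rightarrow> real) \<Rightarrow> ('v \<Rightarrow> real) \<Rightarrow> real \<Rightarrow> 'v \<Rightarrow> 'v \<Rightarrow> real" where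
  "heat_kernel \<omega> \<mu> t x y =
     Lim (finite_subsets_at_top UNIV) (\<lambda>U. dirichlet_heat_kernel \<omega> \<mu> U t x y)"

definition heat_semigroup ::
    "('v \<Rightarrow> 'v \<Rightarrow> real) \<Rightarrow> ('v \<Rightarrow> real) \<Rightarrow> real \<Rightarrow> ('v \<Rightarrow> real) \<Rightarrow> 'v \<Rightarrow> real" where
  "heat_semigroup \<omega> \<mu> t f x = (\<Sum>\<^sub>\<infinity>y\<in>UNIV. \<mu> y * heat_kernel \<omega> \<mu> t x y * f y)"

definition phi ::
    "('v \<Rightarrow> 'v \<Rightarrow> real) \<Rightarrow> ('v \<Rightarrow> real) \<Rightarrow> real \<Rightarrow> ('v \<Rightarrow> real) \<Rightarrow> real \<Rightarrow> 'v \<Rightarrow> real" where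
  "phi \<omega> \<mu> T f t x =
     (let u = (\<lambda>y. sqrt (heat_semigroup \<omega> \<mu> (T - t) f y))
      in heat_semigroup \<omega> \<mu> t (Gamma_form \<omega> \<mu> u u) x)"

text \<open>
  \<open>C\<^sup>\<infinity>\<close> on a set of reals, with derivatives relative to that set: at the endpoints of a closed
  interval these are one-sided.
\<close>

definition smooth_real_on :: "real set \<Rightarrow> (real \<Rightarrow> real) \<Rightarrow> bool" where
  "smooth_real_on S g \<longleftrightarrow>
     (\<exists>D :: nat \<Rightarrow> real \<Rightarrow> real. D 0 = g \<and>
       (\<forall>k. \<forall>t\<in>S. (D k has_real_derivative D (Suc k) t) (at t within S)))"

end

theory Submission
  imports Defs
begin

text \<open>
  Write \<open>u = \<surd>(P\<^bsub>T-t\<^esub>f)\<close>. Then \<open>\<partial>\<^sub>t\<phi> = P\<^sub>t(\<Delta>\<Gamma>(u) + \<partial>\<^sub>t\<Gamma>(u))\<close>, and the function inside \<open>P\<^sub>t\<close> is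
  twice the modified \<open>\<Gamma>\<^sub>2\<close> of \<open>u\<close>. The condition \<open>CDE'\<close> bounds it below by
  \<open>2/n u\<^sup>2(\<Delta> log u)\<^sup>2 + 2K\<Gamma>(u)\<close>; the square is estimated by \<open>z\<^sup>2 \<ge> 2\<gamma>z - \<gamma>\<^sup>2\<close>, and since \<open>\<gamma> \<le> 0\<close> one may
  use \<open>\<Delta> log u \<le> \<Delta>u / u\<close>. As \<open>P\<^sub>t\<close> is positive and commutes with \<open>\<Delta>\<close>, applying it gives the claim.

  Differentiating through \<open>P\<^sub>t\<close> requires \<open>\<partial>\<^sub>t\<Gamma>(u)\<close> to be bounded although \<open>f\<close> need not be bounded away
  from \<open>0\<close>. This holds for \<open>t\<close> away from \<open>T\<close>: a nonnegative function \<open>h\<close> with Lipschitz derivative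
  satisfies \<open>h' \<le> c\<surd>h\<close> away from the left end of its domain, so the derivative of
  \<open>\<surd>(P\<^sub>sf)\<close> is bounded for \<open>s\<close> away from \<open>0\<close>.
\<close>

section \<open>Exponentials of bounded operators with finite range\<close>

text \<open>This series is the common majorant for comparison, the Weierstrass test and Tannery's
  theorem below.\<close>

lemma summable_exp_weights:
  fixes b C M :: real
  shows "summable (\<lambda>k. b ^ k / fact k * (C ^ k * M))"
proof -
  have "summable (\<lambda>k. (b * C) ^ k / fact k * M)"
    using summable_exp[of "b * C"] by (intro summable_mult2) (simp add: field_simps)
  then show ?thesis
    by (simp add: power_mult_distrib mult_ac)
qed

text \<open>Used for two matrices: the Laplacian and the Laplacian plus \<open>D\<close>. The
  row-sum bound makes the operator bounded in the sup norm; finite rows let it commute with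
  pointwise limits and with series.\<close>

locale local_operator =
  fixes N :: "'v \<Rightarrow> 'v set" and a :: "'v \<Rightarrow> 'v \<Rightarrow> real" and C :: real
  assumes finite_N: "finite (N x)"
    and sum_abs_le: "(\<Sum>y\<in>N x. \<bar>a x y\<bar>) \<le> C"
begin

definition op :: "('v \<Rightarrow> real) \<Rightarrow> 'v \<Rightarrow> real" where
  "op f x = (\<Sum>y\<in>N x. a x y * f y)"

definition op_exp :: "real \<Rightarrow> ('v \<Rightarrow> real) \<Rightarrow> 'v \<Rightarrow> real" where
  "op_exp t f x = (\<Sum>k. t ^ k / fact k * (op ^^ k) f x)"

lemma C_nonneg: "C \<ge> 0"
proof -
  have "0 \<le> (\<Sum>y\<in>N undefined. \<bar>a undefined y\<bar>)"
    by (rule sum_nonneg) simp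
  then show ?thesis
    using sum_abs_le[of undefined] by linarith
qed

lemma op_add: "op (\<lambda>y. f y + g y) x = op f x + op g x"
  by (simp add: op_def algebra_simps sum.distrib)

lemma op_scale: "op (\<lambda>y. c * f y) x = c * op f x"
  by (simp add: op_def algebra_simps sum_distrib_left)

lemma op_sum: "op (\<lambda>y. \<Sum>i\<in>I. f i y) x = (\<Sum>i\<in>I. op (f i) x)"
  by (simp add: op_def sum_distrib_left) (rule sum.swap)

lemma iter_add: "(op ^^ k) (\<lambda>y. f y + g y) x = (op ^^ k) f x + (op ^^ k) g x"
proof (induction k arbitrary: x)
  case (Suc k)
  then have "(op ^^ k) (\<lambda>y. f y + g y) = (\<lambda>y. (op ^^ k) f y + (op ^^ k) g y)"
    by auto
  then show ?case
    by (simp add: op_add)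
qed auto

lemma iter_scale: "(op ^^ k) (\<lambda>y. c * f y) x = c * (op ^^ k) f x"
proof (induction k arbitrary: x)
  case (Suc k)
  then have "(op ^^ k) (\<lambda>y. c * f y) = (\<lambda>y. c * (op ^^ k) f y)"
    by auto
  then show ?case
    by (simp add: op_scale)
qed auto

lemma iter_sum: "(op ^^ k) (\<lambda>y. \<Sum>i\<in>I. f i y) x = (\<Sum>i\<in>I. (op ^^ k) (f i) x)"
proof (induction k arbitrary: x)
  case (Suc k)
  then have "(op ^^ k) (\<lambda>y. \<Sum>i\<in>I. f i y) = (\<lambda>y. \<Sum>i\<in>I. (op ^^ k) (f i) y)"
    by auto
  then show ?case
    by (simp add: op_sum)
qed auto

lemma abs_op_le:
  assumes "\<And>y. \<bar>f y\<bar> \<le> M"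
  shows "\<bar>op f x\<bar> \<le> C * M"
proof -
  have M: "0 \<le> M"
    using assms[of undefined] by linarith
  have "\<bar>op f x\<bar> \<le> (\<Sum>y\<in>N x. \<bar>a x y\<bar> * \<bar>f y\<bar>)"
    unfolding op_def by (rule order.trans[OF sum_abs]) (simp add: abs_mult)
  also have "\<dots> \<le> (\<Sum>y\<in>N x. \<bar>a x y\<bar> * M)"
    by (intro sum_mono mult_left_mono assms) auto
  also have "\<dots> \<le> C * M"
    using sum_abs_le[of x] M by (simp flip: sum_distrib_right add: mult_right_mono)
  finally show ?thesis .
qed

lemma abs_iter_le:
  assumes "\<And>y. \<bar>f y\<bar> \<le> M"
  shows "\<bar>(op ^^ k) f x\<bar> \<le> C ^ k * M"
proof (induction k arbitrary: x)
  case (Suc k)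
  then show ?case
    using abs_op_le[of "(op ^^ k) f" "C ^ k * M" x] by (simp add: mult_ac)
qed (use assms in auto)

lemma abs_exp_term_le:
  assumes "\<And>y. \<bar>f y\<bar> \<le> M" "\<bar>t\<bar> \<le> b"
  shows "\<bar>t ^ k / fact k * (op ^^ k) f x\<bar> \<le> b ^ k / fact k * (C ^ k * M)"
  unfolding abs_mult
proof (rule mult_mono)
  show "\<bar>t ^ k / fact k\<bar> \<le> b ^ k / fact k"
    using assms(2) by (simp add: power_abs divide_right_mono power_mono)
  show "\<bar>(op ^^ k) f x\<bar> \<le> C ^ k * M"
    by (rule abs_iter_le) (rule assms)
qed (use assms in auto)

lemma summable_op_exp:
  assumes "\<And>y. \<bar>f y\<bar> \<le> M"
  shows "summable (\<lambda>k. t ^ k / fact k * (op ^^ k) f x)"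
  by (rule summable_comparison_test'[OF summable_exp_weights[of "\<bar>t\<bar>" C M], of 0])
     (use abs_exp_term_le[OF assms order.refl] in auto)

lemma abs_op_exp_le:
  assumes "\<And>y. \<bar>f y\<bar> \<le> M" "\<bar>t\<bar> \<le> b"
  shows "\<bar>op_exp t f x\<bar> \<le> exp (b * C) * M"
proof -
  have "\<bar>op_exp t f x\<bar> \<le> (\<Sum>k. b ^ k / fact k * (C ^ k * M))"
    unfolding op_exp_def real_norm_def[symmetric]
    by (intro norm_suminf_le summable_exp_weights)
       (use abs_exp_term_le[OF assms] in auto)
  also have "(\<lambda>k. b ^ k / fact k * (C ^ k * M)) = (\<lambda>k. (b * C) ^ k /\<^sub>R fact k * M)"
    by (simp add: power_mult_distrib field_simps)
  also have "(\<Sum>k. (b * C) ^ k /\<^sub>R fact k * M) = exp (b * C) * M"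
    unfolding exp_def by (intro suminf_mult2[symmetric] summable_exp_generic)
  finally show ?thesis .
qed

lemma op_exp_0 [simp]: "op_exp 0 f x = f x"
proof -
  \<comment> \<open>As \<open>0 ^ 0 = 1\<close>, exactly the term \<open>k = 0\<close>
    survives.\<close>
  have "op_exp 0 f x = (\<Sum>k\<in>{0}. 0 ^ k / fact k * (op ^^ k) f x)"
    unfolding op_exp_def by (rule suminf_finite) auto
  then show ?thesis
    by simp
qed

lemma op_exp_add:
  assumes "\<And>y. \<bar>f y\<bar> \<le> M" "\<And>y. \<bar>g y\<bar> \<le> M'"
  shows "op_exp t (\<lambda>y. f y + g y) x = op_exp t f x + op_exp t g x"
  unfolding op_exp_def iter_add distrib_left
  by (intro suminf_add[symmetric] summable_op_exp[OF assms(1)] summable_op_exp[OF assms(2)])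

lemma op_exp_scale:
  assumes "\<And>y. \<bar>f y\<bar> \<le> M"
  shows "op_exp t (\<lambda>y. c * f y) x = c * op_exp t f x"
  unfolding op_exp_def iter_scale mult.left_commute[of _ c]
  by (intro suminf_mult summable_op_exp[OF assms])

text \<open>A row sum is finite, so it may be exchanged with the exponential series.\<close>

lemma op_op_exp:
  assumes "\<And>y. \<bar>f y\<bar> \<le> M"
  shows "op (op_exp t f) x = op_exp t (op f) x"
proof -
  have "op (op_exp t f) x = (\<Sum>y\<in>N x. \<Sum>k. a x y * (t ^ k / fact k * (op ^^ k) f y))"
    unfolding op_def[of "op_exp t f"] op_exp_def
    by (intro sum.cong refl suminf_mult[symmetric] summable_op_exp[OF assms])
  also have "\<dots> = (\<Sum>k. \<Sum>y\<in>N x. a x y * (t ^ k / fact k * (op ^^ k) f y))"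
    by (intro suminf_sum[symmetric] summable_mult summable_op_exp[OF assms])
  also have "\<dots> = (\<Sum>k. t ^ k / fact k * (op ^^ Suc k) f x)"
    by (simp add: op_def sum_distrib_left mult_ac)
  finally show ?thesis
    by (simp add: op_exp_def funpow_swap1)
qed

lemma op_tendsto:
  assumes "\<And>y. ((\<lambda>i. f i y) \<longlongrightarrow> g y) F"
  shows "((\<lambda>i. op (f i) x) \<longlongrightarrow> op g x) F"
  unfolding op_def by (intro tendsto_intros assms)

lemma iter_tendsto:
  assumes "\<And>y. ((\<lambda>i. f i y) \<longlongrightarrow> g y) F"
  shows "((\<lambda>i. (op ^^ k) (f i) x) \<longlongrightarrow> (op ^^ k) g x) F"
proof (induction k arbitrary: x)
  case (Suc k)
  then show ?case
    using op_tendsto[of "\<lambda>i. (op ^^ k) (f i)"] by simp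
qed (use assms in auto)

lemma iter_has_derivative:
  assumes "\<And>y. ((\<lambda>s. G s y) has_real_derivative G' y) (at t within S)"
  shows "((\<lambda>s. (op ^^ k) (G s) x) has_real_derivative (op ^^ k) G' x) (at t within S)"
proof (induction k arbitrary: x)
  case (Suc k)
  then show ?case
    by (auto simp: op_def intro!: derivative_eq_intros sum.cong)
qed (use assms in auto)

text \<open>The product rule for the exponential applied to a moving function, by termwise
  differentiation. The bounds on \<open>G\<close> and \<open>G'\<close>, uniform in time and vertex,
  make the differentiated series converge uniformly.\<close>

lemma has_derivative_op_exp:
  assumes deriv: "\<And>s y. s \<in> {0..b} \<Longrightarrow> ((\<lambda>s. G s y) has_real_derivative G' s y) (at s within {0..b})"
    and G: "\<And>s y. s \<in> {0..b} \<Longrightarrow> \<bar>G s y\<bar> \<le> M"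
    and G': "\<And>s y. s \<in> {0..b} \<Longrightarrow> \<bar>G' s y\<bar> \<le> M'"
    and t: "t \<in> {0..b}"
  shows "((\<lambda>s. op_exp s (G s) x) has_real_derivative op_exp t (\<lambda>y. op (G t) y + G' t y) x)
           (at t within {0..b})"
proof -
  define F where "F k s = s ^ k / fact k * (op ^^ k) (G s) x" for k s
  \<comment> \<open>\<open>A\<close> comes from differentiating the weight, \<open>B\<close> from
    differentiating \<open>G\<close>. At \<open>k = 0\<close> the truncated exponent
    \<open>k - 1\<close> is harmless, since the factor \<open>real k\<close> vanishes.\<close>
  define A where "A k s = real k * s ^ (k - 1) / fact k * (op ^^ k) (G s) x" for k s
  define B where "B k s = s ^ k / fact k * (op ^^ k) (G' s) x" for k s
  define W where "W k = real k * b ^ (k - 1) / fact k * (C ^ k * M) + b ^ k / fact k * (C ^ k * M')" for k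
  have b: "0 \<le> b" and M: "0 \<le> M" and M': "0 \<le> M'"
    using t G[OF t, of x] G'[OF t, of x] by auto
  have Suc_weight: "real (Suc k) * s ^ (Suc k - 1) / fact (Suc k) = s ^ k / fact k" for k and s :: real
    by (simp add: fact_Suc del: of_nat_Suc)
  have FAB: "(F k has_real_derivative A k s + B k s) (at s within {0..b})" if "s \<in> {0..b}" for k s
  proof -
    have "((\<lambda>s. s ^ k / fact k) has_real_derivative real k * s ^ (k - 1) / fact k) (at s within {0..b})"
      using DERIV_cdivide[OF DERIV_power[OF DERIV_ident]] by fastforce
    from DERIV_mult[OF this iter_has_derivative[OF deriv[OF that]]]
    show ?thesis
      unfolding F_def A_def B_def
      by (simp add: mult_ac)
  qed
  \<comment> \<open>Shifting the index by one turns the series of \<open>A\<close> into the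
    exponential series of \<open>op (G s)\<close>.\<close>
  have A_Suc: "A (Suc k) s = s ^ k / fact k * (op ^^ k) (op (G s)) x" for k s
    unfolding A_def Suc_weight by (simp add: funpow_swap1)
  have A_0: "A 0 s = 0" for s
    by (simp add: A_def)
  have AW: "\<bar>A k s + B k s\<bar> \<le> W k" if s: "s \<in> {0..b}" for k s
  proof -
    have "\<bar>A k s\<bar> \<le> real k * b ^ (k - 1) / fact k * (C ^ k * M)"
      unfolding A_def abs_mult[of _ "(op ^^ k) (G s) x"]
      using s b M C_nonneg abs_iter_le[of "G s" M k x] G[OF s]
      by (intro mult_mono) (auto intro!: divide_right_mono mult_left_mono power_mono simp: abs_mult)
    moreover have "\<bar>B k s\<bar> \<le> b ^ k / fact k * (C ^ k * M')"
      unfolding B_def using s by (intro abs_exp_term_le G') auto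
    ultimately show ?thesis
      unfolding W_def by linarith
  qed
  have "summable (\<lambda>k. real (Suc k) * b ^ (Suc k - 1) / fact (Suc k) * (C ^ Suc k * M))"
    unfolding Suc_weight using summable_exp_weights[of b C "C * M"] by (simp add: mult_ac)
  then have "summable (\<lambda>k. real k * b ^ (k - 1) / fact k * (C ^ k * M))"
    by (subst (asm) summable_Suc_iff)
  then have "summable W"
    unfolding W_def by (intro summable_add summable_exp_weights)
  then have unif: "uniform_limit {0..b} (\<lambda>n s. \<Sum>k<n. A k s + B k s) (\<lambda>s. \<Sum>k. A k s + B k s) sequentially"
    by (intro Weierstrass_m_test) (use AW in auto)
  have sF: "summable (\<lambda>k. F k s)" if "s \<in> {0..b}" for s
    unfolding F_def using G[OF that] by (rule summable_op_exp)
  obtain g where g: "\<And>s. s \<in> {0..b} \<Longrightarrow> (\<lambda>k. F k s) sums g s"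
      "\<And>s. s \<in> {0..b} \<Longrightarrow> (g has_real_derivative (\<Sum>k. A k s + B k s)) (at s within {0..b})"
    using has_field_derivative_series[OF _ FAB unif t sF[OF t]] by fastforce
  have opG: "\<bar>op (G t) y\<bar> \<le> C * M" for y
    using t by (intro abs_op_le G)
  have sA: "summable (\<lambda>k. A k t)"
  proof -
    have "summable (\<lambda>k. A (Suc k) t)"
      unfolding A_Suc by (rule summable_op_exp[OF opG])
    then show ?thesis
      by (subst (asm) summable_Suc_iff)
  qed
  have sB: "summable (\<lambda>k. B k t)"
    unfolding B_def using G'[OF t] by (rule summable_op_exp)
  have "(\<Sum>k. A k t + B k t) = (\<Sum>k. A k t) + (\<Sum>k. B k t)"
    by (intro suminf_add[symmetric] sA sB)
  also have "(\<Sum>k. A k t) = op_exp t (op (G t)) x"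
    using suminf_split_head[OF sA] by (simp add: A_0 A_Suc op_exp_def)
  also have "(\<Sum>k. B k t) = op_exp t (G' t) x"
    by (simp add: B_def op_exp_def)
  also have "op_exp t (op (G t)) x + op_exp t (G' t) x = op_exp t (\<lambda>y. op (G t) y + G' t y) x"
    using opG G'[OF t] by (intro op_exp_add[symmetric])
  finally have "(g has_real_derivative op_exp t (\<lambda>y. op (G t) y + G' t y) x) (at t within {0..b})"
    using g(2)[OF t] by simp
  moreover have "op_exp s (G s) x = g s" if "s \<in> {0..b}" for s
    using g(1)[OF that] by (simp add: op_exp_def F_def sums_iff)
  ultimately show ?thesis
    unfolding has_field_derivative_def by (rule has_derivative_transform[OF t, rotated])
qed

text \<open>Dominated convergence: each iterate sees only finitely many vertices and so converges,
  and the uniform bound \<open>M\<close> supplies a summable majorant.\<close>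

lemma op_exp_tendsto:
  assumes lim: "\<And>y. ((\<lambda>i. f i y) \<longlongrightarrow> g y) F"
    and bound: "\<And>i y. \<bar>f i y\<bar> \<le> M"
    and "F \<noteq> bot"
  shows "((\<lambda>i. op_exp t (f i) x) \<longlongrightarrow> op_exp t g x) F"
proof -
  have "eventually (\<lambda>(k, i). norm (t ^ k / fact k * (op ^^ k) (f i) x) \<le> \<bar>t\<bar> ^ k / fact k * (C ^ k * M))
          (at_top \<times>\<^sub>F F)"
    using abs_exp_term_le[OF bound order.refl] by (auto intro!: always_eventually)
  moreover have "((\<lambda>i. t ^ k / fact k * (op ^^ k) (f i) x) \<longlongrightarrow> t ^ k / fact k * (op ^^ k) g x) F" for k
    by (intro tendsto_intros iter_tendsto lim)
  ultimately show ?thesis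
    using tannerys_theorem[OF _ _ summable_exp_weights \<open>F \<noteq> bot\<close>,
        of "\<lambda>k i. t ^ k / fact k * (op ^^ k) (f i) x" "\<lambda>k. t ^ k / fact k * (op ^^ k) g x"]
    unfolding op_exp_def by blast
qed

lemma op_exp_sum:
  assumes "\<And>i y. \<bar>f i y\<bar> \<le> M i"
  shows "op_exp t (\<lambda>y. \<Sum>i\<in>I. f i y) x = (\<Sum>i\<in>I. op_exp t (f i) x)"
  unfolding op_exp_def iter_sum sum_distrib_left
  by (intro suminf_sum summable_op_exp[OF assms])

section \<open>Time evolution, the backward equation and the semigroup law\<close>

lemma has_derivative_op_exp_time:
  assumes "\<And>y. \<bar>f y\<bar> \<le> M" "t \<in> {0..b}"
  shows "((\<lambda>s. op_exp s f x) has_real_derivative op (op_exp t f) x) (at t within {0..b})"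
proof -
  have "((\<lambda>s. op_exp s f x) has_real_derivative op_exp t (\<lambda>y. op f y + 0) x) (at t within {0..b})"
    by (rule has_derivative_op_exp[where G = "\<lambda>_. f" and G' = "\<lambda>_ _. 0" and M' = 0])
       (use assms in auto)
  then show ?thesis
    by (simp add: op_op_exp[OF assms(1)])
qed

lemma has_derivative_op_exp_reversed:
  assumes "\<And>y. \<bar>f y\<bar> \<le> M" "t \<in> {0..b}"
  shows "((\<lambda>s. op_exp (b - s) f x) has_real_derivative - op (op_exp (b - t) f) x) (at t within {0..b})"
proof -
  have "((\<lambda>s. op_exp s f x) has_real_derivative op (op_exp (b - t) f) x)
          (at (b - t) within (\<lambda>s. b - s) ` {0..b})"
    by (rule has_field_derivative_subset[OF has_derivative_op_exp_time[OF assms(1), where b = b]]) (use assms(2) in auto)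
  moreover have "((\<lambda>s. b - s) has_real_derivative -1) (at t within {0..b})"
    by (auto intro!: derivative_eq_intros)
  ultimately have "((\<lambda>s. op_exp s f x) \<circ> (\<lambda>s. b - s) has_real_derivative op (op_exp (b - t) f) x * -1)
          (at t within {0..b})"
    by (rule DERIV_image_chain)
  then show ?thesis
    by (simp add: o_def)
qed

text \<open>If \<open>G\<close> solves the backward equation, the two terms of the product rule
  cancel, so \<open>op_exp s (G s) x\<close> is constant in \<open>s\<close>. This one principle
  yields both the semigroup law and the comparison with the shifted operator.\<close>

lemma op_exp_transport:
  assumes "\<And>s y. s \<in> {0..b} \<Longrightarrow> ((\<lambda>s. G s y) has_real_derivative - op (G s) y) (at s within {0..b})"
    and G: "\<And>s y. s \<in> {0..b} \<Longrightarrow> \<bar>G s y\<bar> \<le> M"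
    and t: "t \<in> {0..b}"
  shows "op_exp t (G t) x = G 0 x"
proof -
  have "((\<lambda>s. op_exp s (G s) x) has_real_derivative 0) (at s within {0..b})" if s: "s \<in> {0..b}" for s
  proof -
    have "\<bar>- op (G s) y\<bar> \<le> C * M" if "s \<in> {0..b}" for s y
      using abs_op_le[of "G s" M y] G[OF that] by simp
    then have "((\<lambda>s. op_exp s (G s) x) has_real_derivative op_exp s (\<lambda>y. op (G s) y + - op (G s) y) x)
        (at s within {0..b})"
      using s by (intro has_derivative_op_exp[where G = G and G' = "\<lambda>s y. - op (G s) y" and M = M] assms(1) G)
    then have "((\<lambda>s. op_exp s (G s) x) has_real_derivative op_exp s (\<lambda>y. 0) x) (at s within {0..b})"
      by simp
    moreover have "op_exp s (\<lambda>y. 0) x = 0"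
      using op_exp_scale[of "\<lambda>y. 0" 0 s 0 x] by simp
    ultimately show ?thesis
      by simp
  qed
  then obtain c where c: "\<And>s. s \<in> {0..b} \<Longrightarrow> op_exp s (G s) x = c"
    using has_field_derivative_zero_constant[of "{0..b}" "\<lambda>s. op_exp s (G s) x"] by auto
  show ?thesis
    using c[of 0] c[OF t] t by simp
qed

lemma op_exp_semigroup:
  assumes "\<And>y. \<bar>f y\<bar> \<le> M" "0 \<le> t" "t \<le> b"
  shows "op_exp t (op_exp (b - t) f) x = op_exp b f x"
  using op_exp_transport[where G = "\<lambda>s. op_exp (b - s) f" and b = b and t = t and M = "exp (b * C) * M"]
    has_derivative_op_exp_reversed[OF assms(1)] abs_op_exp_le[OF assms(1)] assms(2,3)
  by simp

text \<open>With nonnegative entries every term of the series is nonnegative, and the term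
  \<open>k = 0\<close> is \<open>f x\<close>.\<close>

lemma op_exp_ge_self:
  assumes a: "\<And>x y. 0 \<le> a x y"
    and f: "\<And>y. 0 \<le> f y" "\<And>y. \<bar>f y\<bar> \<le> M"
    and "0 \<le> t"
  shows "f x \<le> op_exp t f x"
proof -
  have nonneg: "0 \<le> (op ^^ k) f y" for k y
    by (induction k arbitrary: y) (auto simp: op_def intro!: sum_nonneg mult_nonneg_nonneg a f)
  have "(\<Sum>k\<in>{0}. t ^ k / fact k * (op ^^ k) f x) \<le> op_exp t f x"
    unfolding op_exp_def using assms(4)
    by (intro sum_le_suminf summable_op_exp[OF f(2)]) (auto intro!: mult_nonneg_nonneg divide_nonneg_pos nonneg)
  then show ?thesis
    by simp
qed

end

section \<open>The heat semigroup of a weighted graph\<close>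

context weighted_graph
begin

definition D :: real where "D = real_of_ereal (D_mu \<omega> \<mu>)"

text \<open>The vertex itself is inserted to carry the diagonal entry of the Laplacian.\<close>

definition nb :: "'v \<Rightarrow> 'v set" where "nb x = insert x (nbrs \<omega> x)"

text \<open>The matrix of \<open>\<Delta> + c\<close>; for \<open>c = D\<close> its entries are nonnegative.\<close>

definition wt :: "real \<Rightarrow> 'v \<Rightarrow> 'v \<Rightarrow> real" where
  "wt c x y = \<omega> x y / \<mu> x + (if y = x then c - degree_weight \<omega> x / \<mu> x else 0)"

lemma finite_nb: "finite (nb x)"
  by (simp add: nb_def locally_finite)

lemma sum_nb: "(\<Sum>y\<in>nb x. \<omega> x y * f y) = (\<Sum>y\<in>nbrs \<omega> x. \<omega> x y * f y)"
  unfolding nb_def using weight_nonneg[of x x]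
  by (intro sum.mono_neutral_right) (use locally_finite[of x] in \<open>auto simp: nbrs_def\<close>)

lemma degree_nonneg: "0 \<le> degree_weight \<omega> x / \<mu> x"
  using measure_pos[of x] by (auto simp: degree_weight_def intro!: sum_nonneg divide_nonneg_pos weight_nonneg)

lemma degree_le_D: "degree_weight \<omega> x / \<mu> x \<le> D"
proof -
  have "ereal (degree_weight \<omega> x / \<mu> x) \<le> D_mu \<omega> \<mu>"
    unfolding D_mu_def by (rule SUP_upper) auto
  then show ?thesis
    using D_mu_finite unfolding D_def by (cases "D_mu \<omega> \<mu>") auto
qed

lemma D_nonneg: "0 \<le> D"
  using degree_nonneg[of undefined] degree_le_D[of undefined] by linarith

lemma wt_sum: "(\<Sum>y\<in>nb x. wt c x y * f y) = laplacian \<omega> \<mu> f x + c * f x"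
proof -
  have "(\<Sum>y\<in>nb x. wt c x y * f y) =
      (\<Sum>y\<in>nb x. \<omega> x y * f y) / \<mu> x + (c - degree_weight \<omega> x / \<mu> x) * f x"
    using finite_nb[of x]
    by (simp add: wt_def distrib_right sum.distrib sum_divide_distrib if_distribR[of _ "(*)"] if_distrib[of "\<lambda>z. z * _"]
        nb_def cong: if_cong)
  also have "\<dots> = laplacian \<omega> \<mu> f x + c * f x"
    unfolding sum_nb laplacian_def degree_weight_def
    by (simp add: right_diff_distrib sum_subtractf diff_divide_distrib distrib_right left_diff_distrib
        flip: sum_distrib_right)
  finally show ?thesis .
qed

text \<open>The weights contribute at most \<open>D\<close> and the diagonal correction at most
  \<open>D + \<bar>c\<bar>\<close>.\<close>

lemma wt_abs_sum: "(\<Sum>y\<in>nb x. \<bar>wt c x y\<bar>) \<le> 2 * D + \<bar>c\<bar>"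
proof -
  have "(\<Sum>y\<in>nb x. \<bar>wt c x y\<bar>) \<le>
      (\<Sum>y\<in>nb x. \<omega> x y * 1 / \<mu> x + (if y = x then \<bar>c - degree_weight \<omega> x / \<mu> x\<bar> else 0))"
    using weight_nonneg[of x] measure_pos[of x]
    by (intro sum_mono) (auto simp: wt_def abs_if[of "\<omega> x _ / \<mu> x"] divide_less_0_iff not_less
        intro!: order.trans[OF abs_triangle_ineq])
  also have "\<dots> = degree_weight \<omega> x / \<mu> x + \<bar>c - degree_weight \<omega> x / \<mu> x\<bar>"
    unfolding sum.distrib sum_divide_distrib[symmetric] sum_nb
    using finite_nb[of x] by (simp add: degree_weight_def sum.delta nb_def)
  also have "\<dots> \<le> 2 * D + \<bar>c\<bar>"
    using degree_nonneg[of x] degree_le_D[of x] by linarith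
  finally show ?thesis .
qed

lemma local_operator_wt: "local_operator nb (wt c) (2 * D + \<bar>c\<bar>)"
  by unfold_locales (rule finite_nb, rule wt_abs_sum)

sublocale heat: local_operator nb "wt 0" "2 * D"
  rewrites heat_op: "local_operator.op nb (wt 0) = laplacian \<omega> \<mu>"
proof -
  show "local_operator nb (wt 0) (2 * D)"
    using local_operator_wt[of 0] by simp
  then show "local_operator.op nb (wt 0) = laplacian \<omega> \<mu>"
    by (intro ext) (simp add: local_operator.op_def wt_sum)
qed

sublocale shifted: local_operator nb "wt D" "2 * D + \<bar>D\<bar>"
  by (rule local_operator_wt)

section \<open>Positivity and monotonicity of the exponential of the Laplacian\<close>

abbreviation E :: "real \<Rightarrow> ('v \<Rightarrow> real) \<Rightarrow> 'v \<Rightarrow> real" where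
  "E \<equiv> heat.op_exp"

lemma shifted_op: "shifted.op f x = laplacian \<omega> \<mu> f x + D * f x"
  by (simp add: shifted.op_def wt_sum)

lemma wt_D_nonneg: "0 \<le> wt D x y"
  using degree_le_D[of x] weight_nonneg[of x y] measure_pos[of x] by (auto simp: wt_def)

text \<open>The Laplacian plus \<open>D\<close> has a nonnegative matrix, hence preserves
  nonnegative functions.\<close>

lemma laplacian_ge:
  assumes "\<And>y. 0 \<le> h y"
  shows "- (D * h x) \<le> laplacian \<omega> \<mu> h x"
proof -
  have "0 \<le> shifted.op h x"
    unfolding shifted.op_def by (intro sum_nonneg mult_nonneg_nonneg wt_D_nonneg assms)
  then show ?thesis
    by (simp add: shifted_op)
qed

text \<open>Adding the scalar \<open>D\<close> to the generator multiplies the exponential by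
  \<open>exp (D * t)\<close>. This transfers positivity from the nonnegative matrix
  \<open>wt D\<close> to \<open>E\<close>, whose own series has terms of varying sign.\<close>

lemma E_shifted:
  assumes f: "\<And>y. \<bar>f y\<bar> \<le> M" and t: "0 \<le> t"
  shows "exp (D * t) * E t f x = shifted.op_exp t f x"
proof -
  \<comment> \<open>\<open>G\<close> solves the backward equation of the Laplacian: the growth of
    \<open>exp (D * s)\<close> cancels the shift. Its values at \<open>t\<close> and
    \<open>0\<close> give the two sides of the claim.\<close>
  define G where "G s y = exp (D * s) * shifted.op_exp (t - s) f y" for s y
  have deriv: "((\<lambda>s. G s y) has_real_derivative - laplacian \<omega> \<mu> (G s) y) (at s within {0..t})"
    if "s \<in> {0..t}" for s y
  proof -
    have "((\<lambda>s. G s y) has_real_derivative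
        exp (D * s) * - shifted.op (shifted.op_exp (t - s) f) y + D * exp (D * s) * shifted.op_exp (t - s) f y)
        (at s within {0..t})"
      unfolding G_def
      by (rule DERIV_mult' [OF _ shifted.has_derivative_op_exp_reversed[OF f that]])
         (auto intro!: derivative_eq_intros)
    moreover have "laplacian \<omega> \<mu> (G s) y = exp (D * s) * laplacian \<omega> \<mu> (shifted.op_exp (t - s) f) y"
      unfolding G_def by (rule heat.op_scale)
    ultimately show ?thesis
      by (simp add: shifted_op algebra_simps)
  qed
  define B where "B = exp (D * t) * (exp (t * (2 * D + \<bar>D\<bar>)) * M)"
  have bound: "\<bar>G s y\<bar> \<le> B" if "s \<in> {0..t}" for s y
    unfolding G_def B_def abs_mult using that D_nonneg
    by (intro mult_mono shifted.abs_op_exp_le f) (auto intro!: mult_left_mono)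
  have "E t (G t) x = G 0 x"
    using t by (intro heat.op_exp_transport[OF deriv bound]) auto
  moreover have "E t (G t) x = exp (D * t) * E t f x"
    unfolding G_def using heat.op_exp_scale[OF f] by simp
  ultimately show ?thesis
    by (simp add: G_def)
qed

text \<open>The quantitative bound serves twice: it gives strict positivity for positive functions
  and, applied to a difference, monotonicity.\<close>

lemma E_ge:
  assumes "\<And>y. 0 \<le> f y" "\<And>y. \<bar>f y\<bar> \<le> M" "0 \<le> t"
  shows "exp (- (D * t)) * f x \<le> E t f x"
proof -
  have "f x \<le> exp (D * t) * E t f x"
    unfolding E_shifted[OF assms(2,3)] by (rule shifted.op_exp_ge_self[OF wt_D_nonneg assms])
  then have "exp (- (D * t)) * f x \<le> exp (- (D * t)) * (exp (D * t) * E t f x)"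
    by (intro mult_left_mono) auto
  then show ?thesis
    by (simp add: mult.assoc[symmetric] exp_add[symmetric])
qed

lemma E_pos:
  assumes "\<And>y. 0 < f y" "\<And>y. \<bar>f y\<bar> \<le> M" "0 \<le> t"
  shows "0 < E t f x"
proof -
  have "0 < exp (- (D * t)) * f x"
    using assms(1) by simp
  also have "\<dots> \<le> E t f x"
    using assms by (intro E_ge) (auto intro: less_imp_le)
  finally show ?thesis .
qed

lemma E_mono:
  assumes "\<And>y. f y \<le> g y" "\<And>y. \<bar>f y\<bar> \<le> M" "\<And>y. \<bar>g y\<bar> \<le> M'" "0 \<le> t"
  shows "E t f x \<le> E t g x"
proof -
  \<comment> \<open>The difference is written as \<open>g y + - 1 * f y\<close> to fit the rules for
    sums and scalar multiples.\<close>
  have minus_f: "\<bar>- 1 * f y\<bar> \<le> M" for y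
    using assms(2) by simp
  have "\<bar>g y + - 1 * f y\<bar> \<le> M' + M" for y
    using assms(2)[of y] assms(3)[of y] by linarith
  then have "exp (- (D * t)) * (g x + - 1 * f x) \<le> E t (\<lambda>y. g y + - 1 * f y) x"
    using assms(1,4) by (intro E_ge[of "\<lambda>y. g y + - 1 * f y"]) auto
  also have "\<dots> = E t g x - E t f x"
    unfolding heat.op_exp_add[OF assms(3) minus_f] heat.op_exp_scale[OF assms(2)] by simp
  finally have "exp (- (D * t)) * (g x + - 1 * f x) \<le> E t g x - E t f x" .
  moreover have "0 \<le> exp (- (D * t)) * (g x + - 1 * f x)"
    using assms(1)[of x] by (intro mult_nonneg_nonneg) auto
  ultimately show ?thesis
    by linarith
qed

section \<open>Identification of the heat kernel semigroup with the exponential series\<close>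

lemma eventually_mem_finite_sets: "eventually (\<lambda>U. x \<in> U) finite_sets_at_top"
  by (auto simp: eventually_finite_subsets_at_top intro!: exI[of _ "{x}"])

text \<open>Cutting off outside \<open>U\<close> does not increase the sup norm, so the bound is
  uniform in \<open>U\<close>; it dominates the Dirichlet series in the limit.\<close>

lemma abs_dirichlet_iter_le:
  assumes "\<And>y. \<bar>f y\<bar> \<le> M"
  shows "\<bar>(dirichlet_laplacian \<omega> \<mu> U ^^ k) f x\<bar> \<le> (2 * D) ^ k * M"
proof (induction k arbitrary: x)
  case (Suc k)
  have M: "0 \<le> M"
    using assms[of undefined] by linarith
  show ?case
    using heat.abs_op_le[of "\<lambda>y. if y \<in> U then (dirichlet_laplacian \<omega> \<mu> U ^^ k) f y else 0" "(2 * D) ^ k * M" x]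
      Suc M D_nonneg
    by (auto simp: dirichlet_laplacian_def[of \<omega> \<mu> U "(dirichlet_laplacian \<omega> \<mu> U ^^ k) f"] mult_ac)
qed (use assms in auto)

text \<open>At each fixed vertex the cutoff is eventually inactive, and the finite sum in the
  Laplacian passes to the limit.\<close>

lemma dirichlet_iter_tendsto:
  "((\<lambda>U. (dirichlet_laplacian \<omega> \<mu> U ^^ k) f x) \<longlongrightarrow> (laplacian \<omega> \<mu> ^^ k) f x) finite_sets_at_top"
proof (induction k arbitrary: x)
  case (Suc k)
  have "((\<lambda>U. if y \<in> U then (dirichlet_laplacian \<omega> \<mu> U ^^ k) f y else 0) \<longlongrightarrow> (laplacian \<omega> \<mu> ^^ k) f y)
      finite_sets_at_top" for y
    by (rule Lim_transform_eventually[OF Suc[of y]])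
       (use eventually_mem_finite_sets[of y] in eventually_elim, simp)
  then have "((\<lambda>U. laplacian \<omega> \<mu> (\<lambda>y. if y \<in> U then (dirichlet_laplacian \<omega> \<mu> U ^^ k) f y else 0) x)
      \<longlongrightarrow> laplacian \<omega> \<mu> ((laplacian \<omega> \<mu> ^^ k) f) x) finite_sets_at_top"
    by (rule heat.op_tendsto)
  then have "((\<lambda>U. laplacian \<omega> \<mu> (\<lambda>y. if y \<in> U then (dirichlet_laplacian \<omega> \<mu> U ^^ k) f y else 0) x)
      \<longlongrightarrow> (laplacian \<omega> \<mu> ^^ Suc k) f x) finite_sets_at_top"
    by simp
  then show ?case
    by (rule Lim_transform_eventually)
       (use eventually_mem_finite_sets[of x] in eventually_elim,
        simp add: dirichlet_laplacian_def[of \<omega> \<mu> _ "(dirichlet_laplacian \<omega> \<mu> _ ^^ k) f"])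
qed auto

lemma heat_kernel_eq: "heat_kernel \<omega> \<mu> t x y = E t (indicator {y}) x / \<mu> y"
proof -
  have ind: "\<bar>indicator {y} z :: real\<bar> \<le> 1" for z
    by (auto simp: indicator_def)
  let ?a = "\<lambda>k U. t ^ k / fact k * (dirichlet_laplacian \<omega> \<mu> U ^^ k) (indicator {y}) x"
  have "\<bar>?a k U\<bar> \<le> \<bar>t\<bar> ^ k / fact k * ((2 * D) ^ k * 1)" for k U
    unfolding abs_mult
    by (intro mult_mono abs_dirichlet_iter_le[OF ind]) (auto simp: power_abs)
  then have "eventually (\<lambda>(k, U). norm (?a k U) \<le> \<bar>t\<bar> ^ k / fact k * ((2 * D) ^ k * 1)) (at_top \<times>\<^sub>F finite_sets_at_top)"
    by (auto intro!: always_eventually)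
  moreover have "(?a k \<longlongrightarrow> t ^ k / fact k * (laplacian \<omega> \<mu> ^^ k) (indicator {y}) x) finite_sets_at_top" for k
    by (intro tendsto_intros dirichlet_iter_tendsto)
  ultimately have "((\<lambda>U. \<Sum>k. ?a k U) \<longlongrightarrow> E t (indicator {y}) x) finite_sets_at_top"
    using tannerys_theorem[OF _ _ summable_exp_weights, of ?a
        "\<lambda>k. t ^ k / fact k * (laplacian \<omega> \<mu> ^^ k) (indicator {y}) x" finite_sets_at_top "\<bar>t\<bar>" "2 * D" 1]
    unfolding heat.op_exp_def by simp
  then have "((\<lambda>U. (\<Sum>k. ?a k U) / \<mu> y) \<longlongrightarrow> E t (indicator {y}) x / \<mu> y) finite_sets_at_top"
    using measure_pos[of y] by (intro tendsto_intros) auto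
  then have "((\<lambda>U. dirichlet_heat_kernel \<omega> \<mu> U t x y) \<longlongrightarrow> E t (indicator {y}) x / \<mu> y) finite_sets_at_top"
    by (rule Lim_transform_eventually)
       (use eventually_mem_finite_sets[of x] eventually_mem_finite_sets[of y] in eventually_elim,
        simp add: dirichlet_heat_kernel_def)
  then show ?thesis
    unfolding heat_kernel_def by (intro tendsto_Lim) auto
qed

text \<open>A partial sum of the kernel over a finite \<open>U\<close> is \<open>E t\<close> applied
  to \<open>f\<close> cut off outside \<open>U\<close>. Dominated convergence as \<open>U\<close>
  grows gives the infinite sum.\<close>

lemma heat_semigroup_eq:
  assumes f: "\<And>y. \<bar>f y\<bar> \<le> M"
  shows "heat_semigroup \<omega> \<mu> t f = E t f"
proof
  fix x
  have M: "0 \<le> M"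
    using f[of undefined] by linarith
  have partial_sum: "(\<Sum>y\<in>U. \<mu> y * heat_kernel \<omega> \<mu> t x y * f y) = E t (\<lambda>z. indicator U z * f z) x"
    if "finite U" for U
  proof -
    have ind: "\<bar>indicator {y} z :: real\<bar> \<le> 1" for y z :: 'v
      by (auto simp: indicator_def)
    have bound: "\<bar>f y * indicator {y} z\<bar> \<le> M" for y z
      using f[of y] M by (auto simp: indicator_def)
    have "(\<Sum>y\<in>U. f y * indicator {y} z) = (\<Sum>y\<in>U. if y = z then f y else 0)" for z
      by (rule sum.cong) (auto simp: indicator_def)
    then have "(\<lambda>z. indicator U z * f z) = (\<lambda>z. \<Sum>y\<in>U. f y * indicator {y} z)"
      using that by (auto simp: fun_eq_iff indicator_def)
    then have "E t (\<lambda>z. indicator U z * f z) x = (\<Sum>y\<in>U. f y * E t (indicator {y}) x)"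
      using heat.op_exp_sum[where f = "\<lambda>y z. f y * indicator {y} z", OF bound]
        heat.op_exp_scale[OF ind] by simp
    moreover have "\<mu> y * heat_kernel \<omega> \<mu> t x y * f y = f y * E t (indicator {y}) x" for y
      using measure_pos[of y] by (simp add: heat_kernel_eq)
    ultimately show ?thesis
      by (simp only:)
  qed
  have "((\<lambda>U. indicator U y * f y) \<longlongrightarrow> f y) finite_sets_at_top" for y
    by (rule tendsto_eventually) (use eventually_mem_finite_sets[of y] in eventually_elim, simp)
  moreover have "\<bar>indicator U y * f y\<bar> \<le> M" for U y
    using f[of y] M by (auto simp: indicator_def)
  ultimately have "((\<lambda>U. E t (\<lambda>z. indicator U z * f z) x) \<longlongrightarrow> E t f x) finite_sets_at_top"
    by (intro heat.op_exp_tendsto) auto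
  moreover have "eventually (\<lambda>U. E t (\<lambda>z. indicator U z * f z) x =
      (\<Sum>y\<in>U. \<mu> y * heat_kernel \<omega> \<mu> t x y * f y)) finite_sets_at_top"
    by (rule eventually_finite_subsets_at_top_weakI) (simp add: partial_sum)
  ultimately have "((\<lambda>y. \<mu> y * heat_kernel \<omega> \<mu> t x y * f y) has_sum E t f x) UNIV"
    unfolding has_sum_def by (rule Lim_transform_eventually)
  then show "heat_semigroup \<omega> \<mu> t f x = E t f x"
    unfolding heat_semigroup_def by (rule infsumI)
qed

end

section \<open>The square root of a heat flow\<close>

text \<open>Going back from \<open>s\<close> by \<open>d\<close>, the mean value theorem and
  \<open>h \<ge> 0\<close> give a point where \<open>h'\<close> is at most \<open>h s / d\<close>;
  returning to \<open>s\<close> costs at most \<open>L * d\<close>. Taking \<open>d\<close>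
  proportional to \<open>sqrt (h s)\<close> balances both terms.\<close>

lemma deriv_le_sqrt:
  fixes h h' :: "real \<Rightarrow> real"
  assumes deriv: "\<And>r. r \<in> {0..b} \<Longrightarrow> (h has_real_derivative h' r) (at r within {0..b})"
    and h: "\<And>r. r \<in> {0..b} \<Longrightarrow> 0 \<le> h r" "\<And>r. r \<in> {0..b} \<Longrightarrow> h r \<le> B"
    and lip: "\<And>r r'. r \<in> {0..b} \<Longrightarrow> r' \<in> {0..b} \<Longrightarrow> \<bar>h' r - h' r'\<bar> \<le> L * \<bar>r - r'\<bar>"
    and s: "0 < s0" "s0 \<le> s" "s \<le> b" "0 < h s"
  shows "h' s \<le> (sqrt B / s0 + L * s0 / sqrt B) * sqrt (h s)"
proof -
  \<comment> \<open>The factor \<open>s0 / sqrt B\<close> ensures \<open>d \<le> s0 \<le> s\<close>,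
    so that \<open>s - d\<close> stays in the domain.\<close>
  define d where "d = s0 * sqrt (h s) / sqrt B"
  have B: "0 < B"
    using h(2)[of s] s by auto
  have d: "0 < d"
    using s B by (simp add: d_def)
  have "d \<le> s0"
    using s B h(2)[of s] by (simp add: d_def pos_divide_le_eq)
  have "\<exists>r\<in>{s - d..s}. h s - h (s - d) = h' r * (s - (s - d))"
  proof (rule mvt_very_simple)
    show "(h has_derivative (*) (h' r)) (at r within {s - d..s})" if "s - d \<le> r" "r \<le> s" for r
      using DERIV_subset[OF deriv[of r], of "{s - d..s}"] that s \<open>d \<le> s0\<close>
      by (auto simp: has_field_derivative_def)
  qed (use d in auto)
  then obtain r where r: "r \<in> {s - d..s}" "h s - h (s - d) = h' r * d"
    by auto
  have L: "0 \<le> L"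
    using lip[of 0 b] s by (auto simp: zero_le_mult_iff dest: order.trans[OF abs_ge_zero])
  have "h' r * d \<le> h s"
    using r(2) h(1)[of "s - d"] d \<open>d \<le> s0\<close> s by auto
  then have "h' r \<le> h s / d"
    using d by (simp add: pos_le_divide_eq)
  moreover have "\<bar>h' s - h' r\<bar> \<le> L * d"
    using lip[of s r] mult_left_mono[of "\<bar>s - r\<bar>" d L] r(1) s \<open>d \<le> s0\<close> L by auto
  moreover have "h s / d = sqrt B / s0 * sqrt (h s)"
    using s B real_sqrt_mult_self[of "h s"] by (simp add: d_def field_simps)
  ultimately show ?thesis
    by (simp add: d_def field_simps)
qed

context weighted_graph
begin

text \<open>The upper bound is \<open>deriv_le_sqrt\<close> for the heat flow at a fixed vertex,
  whose time derivative is its Laplacian. The lower bound is \<open>laplacian_ge\<close>, with one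
  factor of \<open>sqrt h * sqrt h\<close> estimated by \<open>sqrt B\<close>. The constant does not
  depend on the vertex.\<close>

lemma abs_laplacian_E_le_sqrt:
  assumes f: "\<And>y. 0 < f y" "\<And>y. \<bar>f y\<bar> \<le> M" and s0: "0 < s0"
  shows "\<exists>c. \<forall>s\<in>{s0..b}. \<forall>y. \<bar>laplacian \<omega> \<mu> (E s f) y\<bar> \<le> c * sqrt (E s f y)"
proof -
  define B where "B = exp (b * (2 * D)) * M"
  \<comment> \<open>\<open>L\<close> bounds the second time derivative, that is, the Laplacian
    applied twice to the flow.\<close>
  define L where "L = 2 * D * (exp (b * (2 * D)) * (2 * D * M))"
  define c where "c = max (sqrt B / s0 + L * s0 / sqrt B) (D * sqrt B)"
  have pos: "0 < E s f y" if "0 \<le> s" for s y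
    by (rule E_pos[OF f that])
  have bound: "E s f y \<le> B" if "s \<in> {0..b}" for s y
    unfolding B_def using heat.abs_op_exp_le[of f M s b y] f(2) that by auto
  have lf: "\<bar>laplacian \<omega> \<mu> f y\<bar> \<le> 2 * D * M" for y
    by (rule heat.abs_op_le[OF f(2)])
  have "\<bar>laplacian \<omega> \<mu> (E s f) y\<bar> \<le> c * sqrt (E s f y)" if s: "s \<in> {s0..b}" for s y
  proof -
    have lip: "\<bar>laplacian \<omega> \<mu> (E r f) y - laplacian \<omega> \<mu> (E r' f) y\<bar> \<le> L * \<bar>r - r'\<bar>"
      if "r \<in> {0..b}" "r' \<in> {0..b}" for r r'
      unfolding heat.op_op_exp[OF f(2)] real_norm_def[symmetric]
    proof (rule field_differentiable_bound[OF convex_real_interval(5)])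
      show "((\<lambda>r. E r (laplacian \<omega> \<mu> f) y) has_real_derivative laplacian \<omega> \<mu> (E r (laplacian \<omega> \<mu> f)) y)
          (at r within {0..b})" if "r \<in> {0..b}" for r
        by (rule heat.has_derivative_op_exp_time[OF lf that])
      show "norm (laplacian \<omega> \<mu> (E r (laplacian \<omega> \<mu> f)) y) \<le> L" if "r \<in> {0..b}" for r
        unfolding L_def real_norm_def
        by (rule heat.abs_op_le, rule heat.abs_op_exp_le[OF lf]) (use that in auto)
    qed (use that in auto)
    have "laplacian \<omega> \<mu> (E s f) y \<le> (sqrt B / s0 + L * s0 / sqrt B) * sqrt (E s f y)"
      by (rule deriv_le_sqrt[where h = "\<lambda>s. E s f y" and h' = "\<lambda>s. laplacian \<omega> \<mu> (E s f) y" and b = b])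
         (use s s0 pos bound lip in \<open>auto intro: heat.has_derivative_op_exp_time[OF f(2)] less_imp_le[OF pos]\<close>)
    also have "\<dots> \<le> c * sqrt (E s f y)"
      using s s0 pos[of s y] by (intro mult_right_mono) (auto simp: c_def less_imp_le)
    finally have upper: "laplacian \<omega> \<mu> (E s f) y \<le> c * sqrt (E s f y)" .
    have "- laplacian \<omega> \<mu> (E s f) y \<le> D * (sqrt (E s f y) * sqrt (E s f y))"
      using laplacian_ge[of "E s f" y] pos[of s] s s0 by (simp add: less_imp_le)
    also have "\<dots> \<le> D * (sqrt B * sqrt (E s f y))"
      using bound[of s y] pos[of s y] s s0 D_nonneg by (intro mult_left_mono mult_right_mono) auto
    also have "\<dots> \<le> c * sqrt (E s f y)"
      unfolding mult.assoc[symmetric] using s s0 pos[of s y]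
      by (intro mult_right_mono) (auto simp: c_def less_imp_le)
    finally show ?thesis
      using upper by linarith
  qed
  then show ?thesis
    by blast
qed

section \<open>Calculus of the form \<Gamma>: bilinearity, bounds and time derivative\<close>

lemma Gamma_sym: "Gamma_form \<omega> \<mu> f g x = Gamma_form \<omega> \<mu> g f x"
  by (simp add: Gamma_form_def mult.commute)

lemma Gamma_add_right:
  "Gamma_form \<omega> \<mu> f (\<lambda>y. g y + h y) x = Gamma_form \<omega> \<mu> f g x + Gamma_form \<omega> \<mu> f h x"
  by (simp add: Gamma_form_def distrib_left heat.op_add field_simps)

lemma Gamma_scale_right: "Gamma_form \<omega> \<mu> f (\<lambda>y. c * g y) x = c * Gamma_form \<omega> \<mu> f g x"
  by (simp add: Gamma_form_def mult.left_commute[of _ c] heat.op_scale field_simps)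

text \<open>Each of the three terms of the form is at most \<open>2 * D * A * B\<close>, and their
  sum is halved.\<close>

lemma abs_Gamma_le:
  assumes f: "\<And>y. \<bar>f y\<bar> \<le> A" and g: "\<And>y. \<bar>g y\<bar> \<le> B"
  shows "\<bar>Gamma_form \<omega> \<mu> f g x\<bar> \<le> 3 * D * A * B"
proof -
  have A: "0 \<le> A" and B: "0 \<le> B"
    using f[of x] g[of x] by auto
  have "\<bar>f y * g y\<bar> \<le> A * B" for y
    unfolding abs_mult using f g A by (intro mult_mono) auto
  then have "\<bar>laplacian \<omega> \<mu> (\<lambda>y. f y * g y) x\<bar> \<le> 2 * D * (A * B)"
    by (rule heat.abs_op_le)
  moreover have "\<bar>f x * laplacian \<omega> \<mu> g x\<bar> \<le> A * (2 * D * B)"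
    unfolding abs_mult using f g A by (intro mult_mono heat.abs_op_le) auto
  moreover have "\<bar>g x * laplacian \<omega> \<mu> f x\<bar> \<le> B * (2 * D * A)"
    unfolding abs_mult using f g B by (intro mult_mono heat.abs_op_le) auto
  moreover have "2 * D * (A * B) + A * (2 * D * B) + B * (2 * D * A) = 2 * (3 * D * A * B)"
    by simp
  ultimately show ?thesis
    unfolding Gamma_form_def by (simp only: abs_le_iff) (simp add: field_simps)
qed

lemma Gamma_has_derivative:
  assumes "\<And>y. ((\<lambda>s. u s y) has_real_derivative v y) (at t within S)"
  shows "((\<lambda>s. Gamma_form \<omega> \<mu> (u s) (u s) x) has_real_derivative 2 * Gamma_form \<omega> \<mu> (u t) v x)
           (at t within S)"
proof -
  have lap: "((\<lambda>s. laplacian \<omega> \<mu> (u s) x) has_real_derivative laplacian \<omega> \<mu> v x) (at t within S)"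
    using heat.iter_has_derivative[where k = 1, OF assms] by simp
  have "((\<lambda>s. u s y * u s y) has_real_derivative 2 * (u t y * v y)) (at t within S)" for y
    using DERIV_mult[OF assms assms, of y y] by (simp add: mult_ac)
  then have "((\<lambda>s. (laplacian \<omega> \<mu> ^^ 1) (\<lambda>y. u s y * u s y) x) has_real_derivative
      (laplacian \<omega> \<mu> ^^ 1) (\<lambda>y. 2 * (u t y * v y)) x) (at t within S)"
    by (rule heat.iter_has_derivative)
  then have lap2: "((\<lambda>s. laplacian \<omega> \<mu> (\<lambda>y. u s y * u s y) x) has_real_derivative
      2 * laplacian \<omega> \<mu> (\<lambda>y. u t y * v y) x) (at t within S)"
    by (simp add: heat.op_scale)
  show ?thesis
    unfolding Gamma_form_def
    using DERIV_cdivide[OF DERIV_diff[OF DERIV_diff[OF lap2 DERIV_mult[OF assms lap]] DERIV_mult[OF assms lap]], of x x 2]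
    by (simp add: field_simps)
qed

text \<open>
  Since \<open>\<Delta>u\<^sup>2 = 2u\<Delta>u + 2\<Gamma>(u)\<close>, the time derivative \<open>- \<Delta>u\<^sup>2 / (2u)\<close> of \<open>u = \<surd>(P\<^bsub>T-t\<^esub>f)\<close>
  is \<open>- (\<Delta>u + \<Gamma>(u)/u)\<close>, which turns \<open>\<Delta>\<Gamma>(u) + \<partial>\<^sub>t\<Gamma>(u)\<close> into twice the modified \<open>\<Gamma>\<^sub>2\<close>.
\<close>

lemma two_Gamma2_tilde:
  assumes "\<And>y. u y > 0"
  shows "laplacian \<omega> \<mu> (Gamma_form \<omega> \<mu> u u) x
      + 2 * Gamma_form \<omega> \<mu> u (\<lambda>y. - laplacian \<omega> \<mu> (\<lambda>z. u z * u z) y / (2 * u y)) x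
    = 2 * Gamma2_tilde \<omega> \<mu> u x"
proof -
  have "- laplacian \<omega> \<mu> (\<lambda>z. u z * u z) y / (2 * u y)
      = - 1 * (laplacian \<omega> \<mu> u y + Gamma_form \<omega> \<mu> u u y / u y)" for y
    using assms[of y] by (simp add: Gamma_form_def field_simps)
  then have "Gamma_form \<omega> \<mu> u (\<lambda>y. - laplacian \<omega> \<mu> (\<lambda>z. u z * u z) y / (2 * u y)) x
      = - Gamma_form \<omega> \<mu> u (laplacian \<omega> \<mu> u) x - Gamma_form \<omega> \<mu> u (\<lambda>y. Gamma_form \<omega> \<mu> u u y / u y) x"
    unfolding Gamma_scale_right Gamma_add_right by (simp only: Gamma_scale_right Gamma_add_right) simp
  then show ?thesis
    by (simp add: Gamma2_tilde_def Gamma2_form_def Gamma_sym[of "laplacian \<omega> \<mu> u" u] field_simps)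
qed

text \<open>Here \<open>g\<close> is the value of \<gamma> at one fixed time. The left side is
  grouped as a linear combination of functions to which \<open>E\<close> will be applied term by
  term.\<close>

lemma CDE'_linearized:
  assumes CDE: "CDE' \<omega> \<mu> n K" and n: "n > 0" and g: "g \<le> 0" and u: "\<And>y. u y > 0"
  shows "2 * g / n * laplacian \<omega> \<mu> (\<lambda>y. u y * u y) x
      + ((2 * K - 4 * g / n) * Gamma_form \<omega> \<mu> u u x + (- 2 * g\<^sup>2 / n) * (u x * u x))
    \<le> 2 * Gamma2_tilde \<omega> \<mu> u x"
proof -
  define L where "L = laplacian \<omega> \<mu> (\<lambda>y. ln (u y)) x"
  define l where "l = laplacian \<omega> \<mu> u x"
  have "ln (u y) - ln (u x) \<le> (u y - u x) / u x" for y
    using ln_le_minus_one[of "u y / u x"] u[of x] u[of y] by (simp add: ln_div diff_divide_distrib)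
  then have "(\<Sum>y\<in>nbrs \<omega> x. \<omega> x y * (ln (u y) - ln (u x))) \<le> (\<Sum>y\<in>nbrs \<omega> x. \<omega> x y * ((u y - u x) / u x))"
    by (intro sum_mono mult_left_mono weight_nonneg)
  then have "L \<le> 1 / \<mu> x * (\<Sum>y\<in>nbrs \<omega> x. \<omega> x y * ((u y - u x) / u x))"
    unfolding L_def laplacian_def using measure_pos[of x] by (intro mult_left_mono) auto
  also have "\<dots> = l / u x"
    by (simp add: l_def laplacian_def sum_divide_distrib mult.commute)
  finally have "u x * L \<le> l"
    using u[of x] by (simp add: pos_le_divide_eq mult.commute)
  \<comment> \<open>As \<open>g \<le> 0\<close>, the concavity estimate for the logarithm changes
    direction.\<close>
  then have gL: "g * l \<le> g * (u x * L)"
    using g by (rule mult_left_mono_neg)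
  have "0 \<le> (u x * L - g * u x)\<^sup>2"
    by simp
  also have "\<dots> = (u x)\<^sup>2 * L\<^sup>2 - 2 * u x * (g * (u x * L)) + g\<^sup>2 * (u x)\<^sup>2"
    by (simp add: power2_eq_square algebra_simps)
  also have "\<dots> \<le> (u x)\<^sup>2 * L\<^sup>2 - 2 * u x * (g * l) + g\<^sup>2 * (u x)\<^sup>2"
    using gL u[of x] by simp
  finally have "2 * u x * (g * l) - g\<^sup>2 * (u x)\<^sup>2 \<le> (u x)\<^sup>2 * L\<^sup>2"
    by linarith
  then have "(2 * u x * (g * l) - g\<^sup>2 * (u x)\<^sup>2) / n \<le> (u x)\<^sup>2 * L\<^sup>2 / n"
    by (rule divide_right_mono) (use n in simp)
  moreover have "1 / n * (u x)\<^sup>2 * L\<^sup>2 + K * Gamma_form \<omega> \<mu> u u x \<le> Gamma2_tilde \<omega> \<mu> u x"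
    using CDE u unfolding CDE'_def L_def by blast
  then have "(u x)\<^sup>2 * L\<^sup>2 / n + K * Gamma_form \<omega> \<mu> u u x \<le> Gamma2_tilde \<omega> \<mu> u x"
    by simp
  moreover have "laplacian \<omega> \<mu> (\<lambda>y. u y * u y) x = 2 * Gamma_form \<omega> \<mu> u u x + 2 * u x * l"
    by (simp add: Gamma_form_def l_def diff_divide_distrib)
  \<comment> \<open>The \<Gamma>-part of the Laplacian of the square is exactly cancelled by the
    coefficient \<open>- 4 * g / n\<close>.\<close>
  moreover have "2 * g / n * (2 * Gam + 2 * u x * l) + ((2 * K - 4 * g / n) * Gam + (- 2 * g\<^sup>2 / n) * (u x * u x))
      = 2 * ((2 * u x * (g * l) - g\<^sup>2 * (u x)\<^sup>2) / n) + 2 * (K * Gam)" for Gam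
    using n by (simp add: power2_eq_square field_simps)
  ultimately show ?thesis
    by (simp only:)
qed

text \<open>Differentiability is part of the conclusion: it rests on bounds for \<open>G\<close> and
  \<open>G'\<close> that are uniform over the vertices and over times up to some
  \<open>b < T\<close>.\<close>

lemma phi_has_derivative:
  assumes CDE: "CDE' \<omega> \<mu> n K" and n: "n > 0" and g: "g \<le> 0"
    and f: "\<And>y. f y > 0" "\<And>y. \<bar>f y\<bar> \<le> M" and t: "0 \<le> t" "t < T"
  shows "\<exists>d. ((\<lambda>s. phi \<omega> \<mu> T f s x) has_real_derivative d) (at t within {0..<T}) \<and>
    d \<ge> 2 * g / n * laplacian \<omega> \<mu> (heat_semigroup \<omega> \<mu> T f) x
      + ((2 * K - 4 * g / n) * phi \<omega> \<mu> T f t x + (- 2 * g\<^sup>2 / n) * heat_semigroup \<omega> \<mu> T f x)"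
proof -
  \<comment> \<open>For \<open>s \<le> b\<close> the heat flow has run for at least
    \<open>T - b > 0\<close>, so the square-root bound holds with one constant
    \<open>c\<close>.\<close>
  define b where "b = (t + T) / 2"
  have b: "t < b" "b < T"
    using t by (auto simp: b_def)
  define h where "h s = E (T - s) f" for s
  define u where "u s y = sqrt (h s y)" for s y
  define v where "v s y = - laplacian \<omega> \<mu> (h s) y / (2 * u s y)" for s y
  define G where "G s = Gamma_form \<omega> \<mu> (u s) (u s)" for s
  define G' where "G' s y = 2 * Gamma_form \<omega> \<mu> (u s) (v s) y" for s y
  define B where "B = exp (T * (2 * D)) * M"
  obtain c where c: "\<And>s y. s \<in> {T - b..T} \<Longrightarrow> \<bar>laplacian \<omega> \<mu> (E s f) y\<bar> \<le> c * sqrt (E s f y)"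
    using abs_laplacian_E_le_sqrt[of f M "T - b" T] f b by (meson diff_gt_0_iff_gt)
  have h_pos: "0 < h s y" if "s \<in> {0..b}" for s y
    unfolding h_def using that b by (intro E_pos[OF f]) auto
  have h_le: "\<bar>h s y\<bar> \<le> B" if "s \<in> {0..b}" for s y
    unfolding B_def h_def using that b by (intro heat.abs_op_exp_le f) auto
  have u_pos: "0 < u s y" if "s \<in> {0..b}" for s y
    using h_pos[OF that] by (simp add: u_def)
  have u_sq: "u s y * u s y = h s y" if "s \<in> {0..b}" for s y
    using h_pos[OF that, of y] by (simp add: u_def)
  have u_le: "\<bar>u s y\<bar> \<le> sqrt B" if "s \<in> {0..b}" for s y
    using h_le[OF that, of y] h_pos[OF that, of y] by (simp add: u_def)
  \<comment> \<open>The square root in the bound for the Laplacian cancels the denominator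
    \<open>u s y\<close>.\<close>
  have v_le: "\<bar>v s y\<bar> \<le> c / 2" if "s \<in> {0..b}" for s y
    using c[of "T - s" y] u_pos[OF that, of y] that b
    by (simp add: v_def abs_divide abs_mult u_def h_def divide_le_eq mult_ac)
  have u_deriv: "((\<lambda>s. u s y) has_real_derivative v s y) (at s within {0..b})" if s: "s \<in> {0..b}" for s y
  proof -
    have "((\<lambda>s. h s y) has_real_derivative - laplacian \<omega> \<mu> (h s) y) (at s within {0..b})"
      unfolding h_def using s b
      by (intro DERIV_subset[OF heat.has_derivative_op_exp_reversed[OF f(2), where b = T], of s "{0..b}"]) auto
    then have "((\<lambda>s. sqrt (h s y)) has_real_derivative inverse (sqrt (h s y)) / 2 * - laplacian \<omega> \<mu> (h s) y)
        (at s within {0..b})"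
      by (rule DERIV_chain2[where f = sqrt and g = "\<lambda>s. h s y", OF DERIV_real_sqrt[OF h_pos[OF s]]])
    moreover have "inverse (sqrt (h s y)) / 2 * - laplacian \<omega> \<mu> (h s) y = v s y"
      by (simp add: v_def u_def inverse_eq_divide)
    ultimately show ?thesis
      unfolding u_def by (simp only:)
  qed
  have G_deriv: "((\<lambda>s. G s y) has_real_derivative G' s y) (at s within {0..b})" if "s \<in> {0..b}" for s y
    unfolding G_def G'_def by (rule Gamma_has_derivative[OF u_deriv[OF that]])
  have G_le: "\<bar>G s y\<bar> \<le> 3 * D * sqrt B * sqrt B" if "s \<in> {0..b}" for s y
    unfolding G_def by (intro abs_Gamma_le u_le that)
  have G'_le: "\<bar>G' s y\<bar> \<le> 2 * (3 * D * sqrt B * (c / 2))" if "s \<in> {0..b}" for s y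
  proof -
    have "\<bar>Gamma_form \<omega> \<mu> (u s) (v s) y\<bar> \<le> 3 * D * sqrt B * (c / 2)"
      by (intro abs_Gamma_le u_le v_le that)
    then show ?thesis
      unfolding G'_def by (simp only: abs_mult abs_numeral mult_left_mono)
  qed
  have tb: "t \<in> {0..b}"
    using t b by auto
  define R where "R y = laplacian \<omega> \<mu> (G t) y + G' t y" for y
  have R_eq: "R y = 2 * Gamma2_tilde \<omega> \<mu> (u t) y" for y
    using two_Gamma2_tilde[of "u t" y] u_pos[OF tb] u_sq[OF tb]
    unfolding R_def G_def G'_def v_def by simp
  have R_le: "\<bar>R y\<bar> \<le> 2 * D * (3 * D * sqrt B * sqrt B) + 2 * (3 * D * sqrt B * (c / 2))" for y
    unfolding R_def
    by (rule order.trans[OF abs_triangle_ineq]) (intro add_mono heat.abs_op_le G_le G'_le tb)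
  have phi_eq: "phi \<omega> \<mu> T f s x = E s (G s) x" if "s \<in> {0..b}" for s
    using heat_semigroup_eq[of "G s", OF G_le[OF that]] heat_semigroup_eq[of f, OF f(2)]
    by (simp add: phi_def Let_def G_def[abs_def] u_def[abs_def] h_def)
  have "((\<lambda>s. E s (G s) x) has_real_derivative E t R x) (at t within {0..b})"
    unfolding R_def by (rule heat.has_derivative_op_exp[OF G_deriv G_le G'_le tb])
  then have "((\<lambda>s. phi \<omega> \<mu> T f s x) has_real_derivative E t R x) (at t within {0..b})"
    unfolding has_field_derivative_def by (rule has_derivative_transform[OF tb, rotated]) (rule phi_eq)
  \<comment> \<open>Since \<open>t < b < T\<close>, the two intervals agree near
    \<open>t\<close>.\<close>
  moreover have "at t within {0..b} = at t within {0..<T}"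
    by (rule at_within_nhd[of t "{..<b}"]) (use b in auto)
  ultimately have deriv: "((\<lambda>s. phi \<omega> \<mu> T f s x) has_real_derivative E t R x) (at t within {0..<T})"
    by simp
  define c1 c2 c3 where "c1 = 2 * g / n" and "c2 = 2 * K - 4 * g / n" and "c3 = - 2 * g\<^sup>2 / n"
  have lh_le: "\<bar>laplacian \<omega> \<mu> (h t) y\<bar> \<le> 2 * D * B" for y
    by (intro heat.abs_op_le h_le tb)
  have b1: "\<bar>c1 * laplacian \<omega> \<mu> (h t) y\<bar> \<le> \<bar>c1\<bar> * (2 * D * B)" for y
    unfolding abs_mult by (intro mult_left_mono lh_le) auto
  have b2: "\<bar>c2 * G t y\<bar> \<le> \<bar>c2\<bar> * (3 * D * sqrt B * sqrt B)" for y
    unfolding abs_mult[of c2] by (intro mult_left_mono G_le tb) auto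
  have b3: "\<bar>c3 * h t y\<bar> \<le> \<bar>c3\<bar> * B" for y
    unfolding abs_mult[of c3] by (intro mult_left_mono h_le tb) auto
  have b23: "\<bar>c2 * G t y + c3 * h t y\<bar> \<le> \<bar>c2\<bar> * (3 * D * sqrt B * sqrt B) + \<bar>c3\<bar> * B" for y
    by (rule order.trans[OF abs_triangle_ineq]) (intro add_mono b2 b3)
  have b123: "\<bar>c1 * laplacian \<omega> \<mu> (h t) y + (c2 * G t y + c3 * h t y)\<bar>
      \<le> \<bar>c1\<bar> * (2 * D * B) + (\<bar>c2\<bar> * (3 * D * sqrt B * sqrt B) + \<bar>c3\<bar> * B)" for y
    by (rule order.trans[OF abs_triangle_ineq]) (intro add_mono b1 b23)
  have "c1 * laplacian \<omega> \<mu> (h t) y + (c2 * G t y + c3 * h t y) \<le> R y" for y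
    using CDE'_linearized[where u = "u t" and x = y, OF CDE n g u_pos[OF tb]]
    unfolding R_eq u_sq[OF tb] c1_def c2_def c3_def G_def by simp
  then have "E t (\<lambda>y. c1 * laplacian \<omega> \<mu> (h t) y + (c2 * G t y + c3 * h t y)) x \<le> E t R x"
    by (rule E_mono[OF _ b123 R_le t(1)])
  also have "E t (\<lambda>y. c1 * laplacian \<omega> \<mu> (h t) y + (c2 * G t y + c3 * h t y)) x
      = c1 * E t (laplacian \<omega> \<mu> (h t)) x + (c2 * E t (G t) x + c3 * E t (h t) x)"
    unfolding heat.op_exp_add[OF b1 b23] heat.op_exp_add[OF b2 b3]
      heat.op_exp_scale[OF lh_le] heat.op_exp_scale[OF G_le[OF tb]] heat.op_exp_scale[OF h_le[OF tb]] ..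
  also have "E t (laplacian \<omega> \<mu> (h t)) x = laplacian \<omega> \<mu> (E t (h t)) x"
    using h_le[OF tb] by (rule heat.op_op_exp[symmetric])
  \<comment> \<open>The semigroup law collapses the flow for time \<open>T - t\<close> followed by
    time \<open>t\<close>.\<close>
  also have "E t (h t) = E T f"
    unfolding h_def using t by (intro ext heat.op_exp_semigroup[OF f(2)]) auto
  finally show ?thesis
    using deriv by (auto simp: phi_eq[OF tb] heat_semigroup_eq[of f, OF f(2)] c1_def c2_def c3_def)
qed

end

theorem theorem3p2:
  fixes \<omega> :: "'v \<Rightarrow> 'v \<Rightarrow> real" and \<mu> :: "'v \<Rightarrow> real"
    and n K T :: real
    and \<alpha> \<gamma> :: "real \<Rightarrow> real"
    and f :: "'v \<Rightarrow> real" and x :: 'v and t :: real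
  assumes "weighted_graph \<omega> \<mu>"
    and "n > 0"
    and "CDE' \<omega> \<mu> n K"
    and "T > 0"
    and "smooth_real_on {0..T} \<alpha>" and "\<And>s. s \<in> {0..T} \<Longrightarrow> \<alpha> s > 0"
    and "smooth_real_on {0..T} \<gamma>" and "\<And>s. s \<in> {0..T} \<Longrightarrow> \<gamma> s \<le> 0"
    and "\<And>y. f y > 0" and "bounded (range f)"
    and "0 \<le> t" and "t < T"
  shows "(\<lambda>s. \<alpha> s * phi \<omega> \<mu> T f s x) differentiable (at t within {0..<T}) \<and>
    vector_derivative (\<lambda>s. \<alpha> s * phi \<omega> \<mu> T f s x) (at t within {0..<T}) \<ge>
      (vector_derivative \<alpha> (at t within {0..T}) - 4 * \<alpha> t * \<gamma> t / n + 2 * \<alpha> t * K)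
          * phi \<omega> \<mu> T f t x
        + 2 * \<alpha> t * \<gamma> t / n * laplacian \<omega> \<mu> (heat_semigroup \<omega> \<mu> T f) x
        - 2 * \<alpha> t * (\<gamma> t)\<^sup>2 / n * heat_semigroup \<omega> \<mu> T f x"
proof -
  interpret weighted_graph \<omega> \<mu>
    by fact
  obtain M where M: "\<And>y. \<bar>f y\<bar> \<le> M"
    using assms(10) unfolding bounded_iff real_norm_def by blast
  define g where "g = \<gamma> t"
  have g: "g \<le> 0"
    unfolding g_def using assms(11,12) by (intro assms(8)) auto
  obtain d where d: "((\<lambda>s. phi \<omega> \<mu> T f s x) has_real_derivative d) (at t within {0..<T})"
      "d \<ge> 2 * g / n * laplacian \<omega> \<mu> (heat_semigroup \<omega> \<mu> T f) x
        + ((2 * K - 4 * g / n) * phi \<omega> \<mu> T f t x + (- 2 * g\<^sup>2 / n) * heat_semigroup \<omega> \<mu> T f x)"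
    using phi_has_derivative[where f = f and x = x, OF assms(3,2) g assms(9) M assms(11,12)] by blast
  have tT: "t \<in> {0..T}" and t: "t \<in> {0..<T}"
    using assms(11,12) by auto
  obtain a where a: "(\<alpha> has_real_derivative a) (at t within {0..T})"
    using assms(5) tT unfolding smooth_real_on_def by metis
  then have "((\<lambda>s. \<alpha> s * phi \<omega> \<mu> T f s x) has_real_derivative \<alpha> t * d + a * phi \<omega> \<mu> T f t x) (at t within {0..<T})"
    by (intro DERIV_mult' d(1)) (rule DERIV_subset, auto)
  then have deriv: "((\<lambda>s. \<alpha> s * phi \<omega> \<mu> T f s x) has_vector_derivative \<alpha> t * d + a * phi \<omega> \<mu> T f t x)
      (at t within {0..<T})"
    by (simp add: has_real_derivative_iff_has_vector_derivative)
  \<comment> \<open>Being a limit point makes the one-sided or two-sided derivative unique, so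
    \<open>vector_derivative\<close> equals the value found.\<close>
  have "t islimpt {0..<T}"
    using t by (intro islimpt_subset[OF islimpt_greaterThanLessThan1 _] ) auto
  then have "vector_derivative (\<lambda>s. \<alpha> s * phi \<omega> \<mu> T f s x) (at t within {0..<T}) = \<alpha> t * d + a * phi \<omega> \<mu> T f t x"
    using deriv by (intro vector_derivative_within) (auto simp: trivial_limit_within)
  moreover have "vector_derivative \<alpha> (at t within {0..T}) = a"
    using a assms(4) tT
    by (intro vector_derivative_within_cbox[of 0 T, simplified])
       (auto simp: has_real_derivative_iff_has_vector_derivative)
  moreover have "\<alpha> t * (2 * g / n * laplacian \<omega> \<mu> (heat_semigroup \<omega> \<mu> T f) x
        + ((2 * K - 4 * g / n) * phi \<omega> \<mu> T f t x + (- 2 * g\<^sup>2 / n) * heat_semigroup \<omega> \<mu> T f x)) \<le> \<alpha> t * d"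
    using assms(6)[OF tT] by (intro mult_left_mono d(2)) auto
  ultimately show ?thesis
    using deriv unfolding g_def
    by (auto simp: differentiableI_vector algebra_simps)
qed

end
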